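(* Let $n \ge 3$ be an integer and let $S$ be the skew-butterfly poset. Then $$\operatorname{La}(n,S) = \Sigma(n,2).$$
   Context: $[n]=\{1,\dots,n\}$ and $2^{[n]}$ is its power set. $\Sigma(n,k)$ denotes the sum of the $k$ largest binomial coefficients of the form $\binom{n}{i}$, $0\le i\le n$. A family $\mathcal{A}\subset 2^{[n]}$ is viewed as a poset under inclusion. A poset $P$ is a (weak) subposet of a poset $Q$ if there is an injection $\phi:P\to Q$ such that $x\le y$ in $P$ implies $\phi(x)\le\phi(y)$ in $Q$. $\operatorname{La}(n,P)$ is the size of the largest family $\mathcal{A}\subset 2^{[n]}$ not containing $P$ as a (weak) subposet. The skew-butterfly $S$ is the poset on $5$ distinct elements $a,b,c,d,e$ whose order is generated by the relations $a\le c$, $a\le d$, $b\le c$, $b\le d$ and $b\le e\le d$. *)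

theory Defs
  imports Main
begin

text \<open>A poset is given by a carrier set together with an order predicate on it.\<close>

definition weak_subposet ::
  "'a set \<Rightarrow> ('a \<Rightarrow> 'a \<Rightarrow> bool) \<Rightarrow> 'b set \<Rightarrow> ('b \<Rightarrow> 'b \<Rightarrow> bool) \<Rightarrow> bool" where
  "weak_subposet P leP Q leQ \<longleftrightarrow>
     (\<exists>\<phi>. inj_on \<phi> P \<and> \<phi> ` P \<subseteq> Q \<and> monotone_on P leP leQ \<phi>)"

text \<open>For finite nonempty \<open>P\<close> the maximum below ranges over a finite nonempty set
  (the empty family does not contain \<open>P\<close>).\<close>

definition La :: "nat \<Rightarrow> 'a set \<Rightarrow> ('a \<Rightarrow> 'a \<Rightarrow> bool) \<Rightarrow> nat" where
  "La n P leP =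
     Max {card \<A> | \<A> :: nat set set. \<A> \<subseteq> Pow {1..n} \<and> \<not> weak_subposet P leP \<A> (\<subseteq>)}"

text \<open>The largest coefficients are taken with multiplicity: equal values at different
  indices \<open>i\<close> count separately.\<close>

definition sum_largest_binomials :: "nat \<Rightarrow> nat \<Rightarrow> nat" where
  "sum_largest_binomials n k =
     sum_list (take k (rev (sort (map (\<lambda>i. n choose i) [0..<Suc n]))))"

datatype skew_butterfly = Sa | Sb | Sc | Sd | Se

inductive skew_gen :: "skew_butterfly \<Rightarrow> skew_butterfly \<Rightarrow> bool" where
  "skew_gen Sa Sc"
| "skew_gen Sa Sd"
| "skew_gen Sb Sc"
| "skew_gen Sb Sd"
| "skew_gen Sb Se"
| "skew_gen Se Sd"

definition skew_le :: "skew_butterfly \<Rightarrow> skew_butterfly \<Rightarrow> bool" where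
  "skew_le = skew_gen\<^sup>*\<^sup>*"

lemma skew_le_iff: "skew_le x y \<longleftrightarrow> x = y \<or> skew_gen x y"
proof
  assume "skew_le x y"
  then have "skew_gen\<^sup>*\<^sup>* x y" by (simp add: skew_le_def)
  then show "x = y \<or> skew_gen x y"
    by (induction rule: rtranclp_induct) (auto simp: skew_gen.simps)
qed (auto simp: skew_le_def)

lemma skew_le_partial_order:
  "class.order skew_le (\<lambda>x y. skew_le x y \<and> \<not> skew_le y x)"
  by unfold_locales (auto simp: skew_le_iff skew_gen.simps)

end

theory Submission
  imports Defs Complex_Main "HOL-Combinatorics.Permutations"
begin

text \<open>
  Two consecutive middle levels contain no three-chain, which gives the lower bound. The upper
  bound is a Katona-style averaging argument over cyclic orders.

  Fix a cyclic order of the \<open>n\<close> points and consider the nonempty proper intervals that belong to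
  a skew-butterfly-free family. There are at most \<open>2 * n\<close> of them (\<open>card_le_endpoints\<close>,
  \<open>card_arcs_in_family_le\<close>). To see this, let every left endpoint remove the largest interval
  starting there and every right endpoint the smallest interval ending there. This makes at most
  \<open>2 * n\<close> removals. An interval \<open>e\<close> that survives sits in a chain \<open>b \<subset> e \<subset> d\<close>, where
  \<open>b\<close> is the smallest interval with the right end of \<open>e\<close> and \<open>d\<close> the largest one with its left end.
  Absence of the skew-butterfly then forces some interval in the vicinity, among \<open>b\<close>, \<open>d\<close>, the
  smallest interval with the right end of \<open>d\<close>, and the largest one with the left end of \<open>b\<close>, to be
  removed twice (\<open>charge_exists\<close>), and different survivors force different doubly removed intervals
  (\<open>charge_unique\<close>). So survivors are paid for by wasted removals.

  Averaging over all cyclic orders yields the LYM-type inequality \<open>skew_free_LYM\<close>: the sum of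
  \<open>1 / (n choose card A)\<close> over the family is at most \<open>2\<close>. This bounds the size of the family by
  the sum of the two largest binomial coefficients (\<open>card_le_of_LYM\<close>). The empty set and the full set are not proper
  intervals; before averaging they are exchanged for other sets, preserving the cardinality and
  the absence of skew-butterflies (\<open>replace_empty_set\<close>, \<open>replace_full_set\<close>).
\<close>

section \<open>Skew-butterflies among sets\<close>

text \<open>The letters are those of the poset. The relation between \<open>b\<close> and \<open>d\<close> follows by transitivity.\<close>

definition contains_skew :: "'s set set \<Rightarrow> bool" where
  "contains_skew F \<longleftrightarrow> (\<exists>a\<in>F. \<exists>b\<in>F. \<exists>c\<in>F. \<exists>d\<in>F. \<exists>e\<in>F. distinct [a, b, c, d, e] \<and>
     a \<subseteq> c \<and> a \<subseteq> d \<and> b \<subseteq> c \<and> b \<subseteq> e \<and> e \<subseteq> d)"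

lemma contains_skewI:
  assumes "a \<in> F" "b \<in> F" "c \<in> F" "d \<in> F" "e \<in> F" "distinct [a, b, c, d, e]"
    "a \<subseteq> c" "a \<subseteq> d" "b \<subseteq> c" "b \<subseteq> e" "e \<subseteq> d"
  shows "contains_skew F"
  using assms unfolding contains_skew_def by blast

lemma contains_skewE:
  assumes "contains_skew F"
  obtains a b c d e where "a \<in> F" "b \<in> F" "c \<in> F" "d \<in> F" "e \<in> F" "distinct [a, b, c, d, e]"
    "a \<subseteq> c" "a \<subseteq> d" "b \<subseteq> c" "b \<subseteq> e" "e \<subseteq> d"
  using assms unfolding contains_skew_def by blast

lemma contains_skew_iff_weak_subposet:
  "weak_subposet (UNIV :: skew_butterfly set) skew_le F (\<subseteq>) \<longleftrightarrow> contains_skew F"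
proof
  assume "weak_subposet (UNIV :: skew_butterfly set) skew_le F (\<subseteq>)"
  then obtain f :: "skew_butterfly \<Rightarrow> 'a set" where inj: "inj f" and ran: "range f \<subseteq> F"
    and mono: "monotone_on UNIV skew_le (\<subseteq>) f"
    unfolding weak_subposet_def by auto
  have gen: "f x \<subseteq> f y" if "skew_gen x y" for x y
    using mono that by (auto simp: monotone_on_def skew_le_iff)
  show "contains_skew F"
    by (rule contains_skewI[of "f Sa" _ "f Sb" "f Sc" "f Sd" "f Se"])
      (use ran gen in \<open>auto simp: inj_eq[OF inj] intro: skew_gen.intros\<close>)
next
  assume "contains_skew F"
  then obtain a b c d e where mem: "a \<in> F" "b \<in> F" "c \<in> F" "d \<in> F" "e \<in> F"
    and dist: "distinct [a, b, c, d, e]"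
    and sub: "a \<subseteq> c" "a \<subseteq> d" "b \<subseteq> c" "b \<subseteq> e" "e \<subseteq> d"
    by (rule contains_skewE)
  define f where "f = case_skew_butterfly a b c d e"
  have "inj f"
  proof (rule injI)
    show "x = y" if "f x = f y" for x y
      using that dist by (cases x; cases y) (auto simp: f_def)
  qed
  moreover have "f x \<in> F" for x
    using mem by (cases x) (auto simp: f_def)
  moreover have "monotone_on UNIV skew_le (\<subseteq>) f"
    unfolding monotone_on_def
    using sub by (auto simp: skew_le_iff skew_gen.simps f_def)
  ultimately show "weak_subposet (UNIV :: skew_butterfly set) skew_le F (\<subseteq>)"
    unfolding weak_subposet_def by blast
qed

lemma contains_skew_map:
  assumes "contains_skew F" "inj_on g F" "g ` F \<subseteq> G"
    and mono: "\<And>A B. A \<in> F \<Longrightarrow> B \<in> F \<Longrightarrow> A \<subseteq> B \<Longrightarrow> g A \<subseteq> g B"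
  shows "contains_skew G"
proof -
  obtain a b c d e where mem: "a \<in> F" "b \<in> F" "c \<in> F" "d \<in> F" "e \<in> F"
    and dist: "distinct [a, b, c, d, e]"
    and sub: "a \<subseteq> c" "a \<subseteq> d" "b \<subseteq> c" "b \<subseteq> e" "e \<subseteq> d"
    using assms(1) by (rule contains_skewE)
  have "distinct [g a, g b, g c, g d, g e]"
    using dist mem by (auto simp: inj_on_eq_iff[OF assms(2)])
  moreover have "g x \<in> G" if "x \<in> F" for x
    using assms(3) that by blast
  ultimately show ?thesis
    using mem sub by (intro contains_skewI[of "g a" _ "g b" "g c" "g d" "g e"] mono)
qed

text \<open>The skew-butterfly is self-dual: reversing its order exchanges \<open>a\<close> with \<open>c\<close> and \<open>b\<close> with \<open>d\<close>,
and fixes \<open>e\<close>.\<close>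

lemma contains_skew_antimap:
  assumes "contains_skew F" "inj_on g F" "g ` F \<subseteq> G"
    and anti: "\<And>A B. A \<in> F \<Longrightarrow> B \<in> F \<Longrightarrow> A \<subseteq> B \<Longrightarrow> g B \<subseteq> g A"
  shows "contains_skew G"
proof -
  obtain a b c d e where mem: "a \<in> F" "b \<in> F" "c \<in> F" "d \<in> F" "e \<in> F"
    and dist: "distinct [a, b, c, d, e]"
    and sub: "a \<subseteq> c" "a \<subseteq> d" "b \<subseteq> c" "b \<subseteq> e" "e \<subseteq> d"
    using assms(1) by (rule contains_skewE)
  have "distinct [g c, g d, g a, g b, g e]"
    using dist mem by (auto simp: inj_on_eq_iff[OF assms(2)])
  moreover have "g x \<in> G" if "x \<in> F" for x
    using assms(3) that by blast
  ultimately show ?thesis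
    using mem sub by (intro contains_skewI[of "g c" _ "g d" "g a" "g b" "g e"] anti)
qed

section \<open>Families of sets with two endpoints\<close>

text \<open>This isolates what the argument uses of the intervals of a cyclic order. A member is named by the
pair of its endpoints. Intervals with a common endpoint are nested; the crossing axiom is the only
further geometric fact. There \<open>b\<close> arises from \<open>e\<close> by moving the left end inwards and \<open>d\<close> by moving the
right end outwards, \<open>a\<close> shares the right end of \<open>d\<close>, and \<open>c\<close> shares the left end of \<open>b\<close>.\<close>

locale crossing_family =
  fixes E :: "('v \<times> 'w) set" and I :: "'v \<times> 'w \<Rightarrow> 's set"
  assumes fin: "finite E"
    and inj: "inj_on I E"
    and same_left: "\<lbrakk>x \<in> E; y \<in> E; fst x = fst y\<rbrakk> \<Longrightarrow> I x \<subseteq> I y \<or> I y \<subseteq> I x"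
    and same_right: "\<lbrakk>x \<in> E; y \<in> E; snd x = snd y\<rbrakk> \<Longrightarrow> I x \<subseteq> I y \<or> I y \<subseteq> I x"
    and crossing: "\<lbrakk>a \<in> E; b \<in> E; c \<in> E; d \<in> E; e \<in> E;
        snd b = snd e; fst e = fst d; snd a = snd d; fst c = fst b;
        I b \<subset> I e; I e \<subset> I d; I a \<subset> I d; I b \<subset> I c\<rbrakk>
      \<Longrightarrow> I b \<subseteq> I a \<or> I c \<subseteq> I d \<or> I a \<subseteq> I c"
    and skew_free: "\<not> contains_skew (I ` E)"
begin

lemma no_skew:
  assumes "a \<in> E" "b \<in> E" "c \<in> E" "d \<in> E" "e \<in> E" "distinct [a, b, c, d, e]"
    and "I a \<subseteq> I c" "I a \<subseteq> I d" "I b \<subseteq> I c" "I b \<subseteq> I e" "I e \<subseteq> I d"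
  shows False
proof -
  have "distinct [I a, I b, I c, I d, I e]"
    using assms(1-6) by (auto simp: inj_on_eq_iff[OF inj])
  then have "contains_skew (I ` E)"
    by (intro contains_skewI[of "I a" _ "I b" "I c" "I d" "I e"]) (use assms in auto)
  with skew_free show False ..
qed

lemma strict: "x \<in> E \<Longrightarrow> y \<in> E \<Longrightarrow> x \<noteq> y \<Longrightarrow> I x \<subseteq> I y \<Longrightarrow> I x \<subset> I y"
  by (auto simp: inj_on_eq_iff[OF inj])

definition top_at where
  "top_at l = (SOME t. t \<in> E \<and> fst t = l \<and> (\<forall>y\<in>E. fst y = l \<longrightarrow> I y \<subseteq> I t))"

definition bot_at where
  "bot_at r = (SOME t. t \<in> E \<and> snd t = r \<and> (\<forall>y\<in>E. snd y = r \<longrightarrow> I t \<subseteq> I y))"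

text \<open>Since the members with a given endpoint are nested, a maximal one is largest and a minimal one is
smallest.\<close>

lemma top_at:
  assumes "x \<in> E"
  shows "top_at (fst x) \<in> E" "fst (top_at (fst x)) = fst x"
    and "\<And>y. y \<in> E \<Longrightarrow> fst y = fst x \<Longrightarrow> I y \<subseteq> I (top_at (fst x))"
proof -
  let ?X = "{y \<in> E. fst y = fst x}"
  have "finite (I ` ?X)" "I ` ?X \<noteq> {}" using fin assms by (simp, blast)
  then obtain t where t: "t \<in> ?X" and max: "\<forall>y\<in>?X. I t \<subseteq> I y \<longrightarrow> I t = I y"
    using finite_has_maximal[of "I ` ?X"] by (metis (no_types, lifting) imageE imageI)
  then have "\<exists>t. t \<in> E \<and> fst t = fst x \<and> (\<forall>y\<in>E. fst y = fst x \<longrightarrow> I y \<subseteq> I t)"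
    using same_left by (intro exI[of _ t]) fastforce
  from someI_ex[OF this, folded top_at_def]
  show "top_at (fst x) \<in> E" "fst (top_at (fst x)) = fst x"
    "\<And>y. y \<in> E \<Longrightarrow> fst y = fst x \<Longrightarrow> I y \<subseteq> I (top_at (fst x))" by auto
qed

lemma bot_at:
  assumes "x \<in> E"
  shows "bot_at (snd x) \<in> E" "snd (bot_at (snd x)) = snd x"
    and "\<And>y. y \<in> E \<Longrightarrow> snd y = snd x \<Longrightarrow> I (bot_at (snd x)) \<subseteq> I y"
proof -
  let ?X = "{y \<in> E. snd y = snd x}"
  have "finite (I ` ?X)" "I ` ?X \<noteq> {}" using fin assms by (simp, blast)
  then obtain t where t: "t \<in> ?X" and min: "\<forall>y\<in>?X. I y \<subseteq> I t \<longrightarrow> I t = I y"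
    using finite_has_minimal[of "I ` ?X"] by (metis (no_types, lifting) imageE imageI)
  then have "\<exists>t. t \<in> E \<and> snd t = snd x \<and> (\<forall>y\<in>E. snd y = snd x \<longrightarrow> I t \<subseteq> I y)"
    using same_right by (intro exI[of _ t]) fastforce
  from someI_ex[OF this, folded bot_at_def]
  show "bot_at (snd x) \<in> E" "snd (bot_at (snd x)) = snd x"
    "\<And>y. y \<in> E \<Longrightarrow> snd y = snd x \<Longrightarrow> I (bot_at (snd x)) \<subseteq> I y" by auto
qed

text \<open>Each left endpoint removes its largest member and each right endpoint its smallest one. The
\<open>inner\<close> members survive, and the \<open>corner\<close> members are removed twice. So it suffices to find at
least as many corner members as inner ones.\<close>

definition inner where
  "inner = {e \<in> E. e \<noteq> top_at (fst e) \<and> e \<noteq> bot_at (snd e)}"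

definition corner where
  "corner = {f \<in> E. f = top_at (fst f) \<and> f = bot_at (snd f)}"

abbreviation up where "up e \<equiv> top_at (fst e)"
abbreviation down where "down e \<equiv> bot_at (snd e)"

lemma inner_facts:
  assumes "e \<in> inner"
  shows "e \<in> E" "up e \<in> E" "down e \<in> E" "fst (up e) = fst e" "snd (down e) = snd e"
    "I (down e) \<subset> I e" "I e \<subset> I (up e)" "snd (up e) \<noteq> snd e" "fst (down e) \<noteq> fst e"
proof -
  show e: "e \<in> E" using assms by (simp add: inner_def)
  show "up e \<in> E" "down e \<in> E" "fst (up e) = fst e" "snd (down e) = snd e"
    using top_at[OF e] bot_at[OF e] by auto
  show "I (down e) \<subset> I e" "I e \<subset> I (up e)"
    using assms e strict[OF bot_at(1)[OF e] e _ bot_at(3)[OF e e]]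
      strict[OF e top_at(1)[OF e] _ top_at(3)[OF e e]]
    by (auto simp: inner_def)
  show "snd (up e) \<noteq> snd e" "fst (down e) \<noteq> fst e"
    using assms top_at[OF e] bot_at[OF e] unfolding inner_def by (auto simp: prod_eq_iff)
qed

text \<open>Two inner members \<open>x \<subset> y\<close> with the same left end would give the four-chain
\<open>down x \<subset> x \<subset> y \<subset> up y\<close>. A further set below the third member of a four-chain, here \<open>down y\<close>,
completes a skew-butterfly.\<close>

lemma inner_left_unique:
  assumes "e1 \<in> inner" "e2 \<in> inner" "fst e1 = fst e2"
  shows "e1 = e2"
proof -
  have *: False if "x \<in> inner" "y \<in> inner" "fst x = fst y" "x \<noteq> y" "I x \<subseteq> I y" for x y
  proof (rule no_skew[of "down y" "down x" "up y" y x])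
    note x = inner_facts[OF that(1)] and y = inner_facts[OF that(2)]
    have "snd x \<noteq> snd y" using that by (auto simp: prod_eq_iff)
    then show "distinct [down y, down x, up y, y, x]"
      using x y that by (auto simp: prod_eq_iff)
  qed (use that inner_facts[OF that(1)] inner_facts[OF that(2)] in auto)
  show ?thesis
    using *[of e1 e2] *[of e2 e1] same_left[of e1 e2] assms inner_facts(1) by metis
qed

text \<open>Dually, a further set above the second member of a four-chain completes a skew-butterfly.\<close>

lemma inner_right_unique:
  assumes "e1 \<in> inner" "e2 \<in> inner" "snd e1 = snd e2"
  shows "e1 = e2"
proof -
  have *: False if "x \<in> inner" "y \<in> inner" "snd x = snd y" "x \<noteq> y" "I x \<subseteq> I y" for x y
  proof (rule no_skew[of x "down x" "up x" "up y" y])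
    note x = inner_facts[OF that(1)] and y = inner_facts[OF that(2)]
    have "fst x \<noteq> fst y" using that by (auto simp: prod_eq_iff)
    then show "distinct [x, down x, up x, up y, y]"
      using x y that by (auto simp: prod_eq_iff)
  qed (use that inner_facts[OF that(1)] inner_facts[OF that(2)] in auto)
  show ?thesis
    using *[of e1 e2] *[of e2 e1] same_right[of e1 e2] assms inner_facts(1) by metis
qed

text \<open>An inner member is going to be charged to a corner member \<open>f\<close>. The corner member found below is one
of \<open>up e\<close>, \<open>down e\<close>, \<open>down (up e)\<close>, \<open>up (down e)\<close>, but in the last two cases all that matters for
injectivity is that it lies strictly between \<open>down e\<close> and \<open>up e\<close>.\<close>

definition charges where
  "charges e f \<longleftrightarrow> f = up e \<or> f = down e \<or> I (down e) \<subset> I f \<and> I f \<subset> I (up e)"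

text \<open>Put \<open>b = down e\<close>, \<open>d = up e\<close>, \<open>a = down d\<close> and \<open>c = up b\<close>. If \<open>a = d\<close> or \<open>b = c\<close>, that set is a corner.
Otherwise \<open>a \<subset> d\<close> and \<open>b \<subset> c\<close>, and \<open>a \<subseteq> c\<close> would make \<open>a, b, c, d, e\<close> a skew-butterfly unless
\<open>a = c\<close>. The crossing axiom leaves \<open>b \<subseteq> a\<close> or \<open>c \<subseteq> d\<close>. If \<open>b \<subseteq> a\<close>, then \<open>a\<close> is a corner, as
otherwise \<open>up a\<close> contains both \<open>a\<close> and \<open>b\<close> and serves as the second maximal element next to \<open>d\<close>.
Dually \<open>c\<close> is a corner if \<open>c \<subseteq> d\<close>.\<close>

lemma charge_exists:
  assumes "e \<in> inner"
  obtains f where "f \<in> corner" "charges e f"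
proof -
  define a b c d where "a = down (up e)" and "b = down e" and "c = up (down e)" and "d = up e"
  note e = inner_facts[OF assms, folded b_def d_def]
  have ud: "a \<in> E" "snd a = snd d" "I a \<subseteq> I d" "c \<in> E" "fst c = fst b" "I b \<subseteq> I c"
    using bot_at[OF inner_facts(2)[OF assms]] top_at[OF inner_facts(3)[OF assms]] inner_facts[OF assms]
    by (auto simp: a_def b_def c_def d_def)
  have ext: "d = up d" "b = down b" "a = down a" "c = up c"
    using e ud by (simp_all add: a_def b_def c_def d_def)
  consider "a = d" | "b = c" | "a \<noteq> d" "b \<noteq> c" "I b \<subseteq> I a"
    | "a \<noteq> d" "b \<noteq> c" "I c \<subseteq> I d" | "a \<noteq> d" "b \<noteq> c" "I a \<subseteq> I c" "\<not> I b \<subseteq> I a"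
    using crossing[of a b c d e] e ud strict[of a d] strict[of b c] by auto
  then show thesis
  proof cases
    case 1
    then show thesis using ext e by (intro that[of d]) (auto simp: corner_def charges_def d_def)
  next
    case 2
    then show thesis using ext e by (intro that[of b]) (auto simp: corner_def charges_def b_def)
  next
    case 3
    have "fst a \<noteq> fst d" using 3 ud by (auto simp: prod_eq_iff)
    have "a = up a"
    proof (rule ccontr)
      assume ne: "a \<noteq> up a"
      note t = top_at[OF ud(1)]
      have aa: "I a \<subset> I (up a)" using ne t ud(1) strict by auto
      have "distinct [a, b, up a, d, e]"
        using \<open>fst a \<noteq> fst d\<close> 3 e ud t aa ne by auto
      then show False
        by (rule no_skew[rotated 5]) (use 3 e ud t aa in auto)
    qed
    moreover have "b \<noteq> a" using e ud by auto
    then have "I b \<subset> I a" "I a \<subset> I d"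
      using 3 e(1-3) ud by (simp_all add: strict)
    ultimately show thesis using ext ud
      by (intro that[of a]) (auto simp: corner_def charges_def b_def d_def)
  next
    case 4
    have "snd c \<noteq> snd b" using 4 ud by (auto simp: prod_eq_iff)
    have "c = down c"
    proof (rule ccontr)
      assume ne: "c \<noteq> down c"
      note t = bot_at[OF ud(4)]
      have cc: "I (down c) \<subset> I c" using ne t ud(4) strict by auto
      have "distinct [down c, b, c, d, e]"
        using \<open>snd c \<noteq> snd b\<close> 4 e ud t cc ne by auto
      then show False
        by (rule no_skew[rotated 5]) (use 4 e ud t cc in auto)
    qed
    moreover have "c \<noteq> d" using e ud by auto
    then have "I b \<subset> I c" "I c \<subset> I d"
      using 4 e(1-3) ud by (simp_all add: strict)
    ultimately show thesis using ext ud
      by (intro that[of c]) (auto simp: corner_def charges_def b_def d_def)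
  next
    case 5
    then have "a \<noteq> c" using ud by auto
    then have "distinct [a, b, c, d, e]" using 5 e ud by auto
    then have False
      by (rule no_skew[rotated 5]) (use 5 e ud in auto)
    then show thesis ..
  qed
qed

text \<open>If distinct inner \<open>x\<close> and \<open>y\<close> both charge \<open>f\<close>, their endpoints differ, hence so do their tops and
bottoms. If \<open>f\<close> is the top of one and the bottom of the other, there is a five-chain, in which
the skew-butterfly is weakly contained. If \<open>f\<close> is the
top or bottom of \<open>x\<close> and lies between \<open>down y\<close> and \<open>up y\<close>, there is a four-chain through \<open>x\<close>, \<open>f\<close> and
one more set on each side, and the remaining one of \<open>down y\<close>, \<open>up y\<close> completes a skew-butterfly.
If \<open>f\<close> lies strictly between for both, then two sets below \<open>f\<close> and two above it form one with \<open>f\<close>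
in the middle.\<close>

lemma charge_unique:
  assumes inner: "x \<in> inner" "y \<in> inner" and f: "f \<in> E" and charges: "charges x f" "charges y f"
  shows "x = y"
proof (rule ccontr)
  assume "x \<noteq> y"
  have asym: "\<not> (f = up x \<and> f = down y)"
    "\<not> ((f = up x \<or> f = down x) \<and> I (down y) \<subset> I f \<and> I f \<subset> I (up y))"
    and ne: "down x \<noteq> down y" "up x \<noteq> up y"
    if inner: "x \<in> inner" "y \<in> inner" and "x \<noteq> y" for x y
  proof -
    \<comment> \<open>Opaque names keep the simplifier from rewriting a top or bottom set in terms of itself.\<close>
    define x0 x1 y0 y1 where "x0 = down x" and "x1 = up x" and "y0 = down y" and "y1 = up y"
    note x = inner_facts[OF inner(1), folded x0_def x1_def] and y = inner_facts[OF inner(2), folded y0_def y1_def]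
    have "fst x \<noteq> fst y" "snd x \<noteq> snd y"
      using inner_left_unique inner_right_unique inner \<open>x \<noteq> y\<close> by blast+
    then have ne: "x0 \<noteq> y0" "x1 \<noteq> y1" "y0 \<noteq> x" "y1 \<noteq> x"
      using x y by auto
    then show "down x \<noteq> down y" "up x \<noteq> up y"
      by (simp_all add: x0_def x1_def y0_def y1_def)
    show "\<not> (f = up x \<and> f = down y)"
    proof (unfold x1_def[symmetric] y0_def[symmetric], rule notI)
      assume "f = x1 \<and> f = y0"
      then have chain: "I x0 \<subset> I x" "I x \<subset> I f" "I f \<subset> I y" "I y \<subset> I y1" using x y by auto
      then have "distinct (map I [x0, x, y, y1, f])"
        by (simp only: list.map distinct.simps list.set insert_iff empty_iff de_Morgan_disj simp_thms)
          (intro conjI; order)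
      then have "distinct [x0, x, y, y1, f]" by (simp only: distinct_map)
      then show False by (rule no_skew[rotated 5]) (use chain x y f in auto)
    qed
    show "\<not> ((f = up x \<or> f = down x) \<and> I (down y) \<subset> I f \<and> I f \<subset> I (up y))"
    proof (unfold x0_def[symmetric] x1_def[symmetric] y0_def[symmetric] y1_def[symmetric], rule notI)
      assume *: "(f = x1 \<or> f = x0) \<and> I y0 \<subset> I f \<and> I f \<subset> I y1"
      then consider "f = x1" | "f = x0" by blast
      then show False
      proof cases
        case 1
        then have "distinct [y0, x0, y1, f, x]" using * x y ne by auto
        then show False by (rule no_skew[rotated 5]) (use * 1 x y in auto)
      next
        case 2
        then have "distinct [y0, f, y1, x1, x]" using * x y ne by auto
        then show False by (rule no_skew[rotated 5]) (use * 2 x y in auto)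
      qed
    qed
  qed
  define x0 x1 y0 y1 where "x0 = down x" and "x1 = up x" and "y0 = down y" and "y1 = up y"
  note x = inner_facts[OF inner(1), folded x0_def x1_def] and y = inner_facts[OF inner(2), folded y0_def y1_def]
  have ne': "x0 \<noteq> y0" "x1 \<noteq> y1"
    using ne[OF inner \<open>x \<noteq> y\<close>] by (simp_all add: x0_def x1_def y0_def y1_def)
  have btw: "I x0 \<subset> I f" "I f \<subset> I x1" "I y0 \<subset> I f" "I f \<subset> I y1"
    using charges asym[OF inner \<open>x \<noteq> y\<close>] asym[OF inner(2,1) \<open>x \<noteq> y\<close>[symmetric]] ne'
    unfolding charges_def x0_def[symmetric] x1_def[symmetric] y0_def[symmetric] y1_def[symmetric]
    by argo+
  then have "distinct [x0, y0, x1, y1, f]" using ne' by auto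
  then show False by (rule no_skew[rotated 5]) (use btw x y f in auto)
qed

lemma card_inner_le_card_corner: "card inner \<le> card corner"
proof -
  have "\<forall>e\<in>inner. \<exists>f. f \<in> corner \<and> charges e f"
    using charge_exists by blast
  then obtain g where g: "\<forall>e\<in>inner. g e \<in> corner \<and> charges e (g e)"
    by metis
  have "corner \<subseteq> E" by (auto simp: corner_def)
  have "inj_on g inner"
  proof (rule inj_onI)
    fix x y assume "x \<in> inner" "y \<in> inner" "g x = g y"
    then show "x = y"
      using charge_unique[of x y "g x"] g \<open>corner \<subseteq> E\<close> by fastforce
  qed
  moreover have "finite corner" using \<open>corner \<subseteq> E\<close> fin finite_subset by blast
  moreover have "g ` inner \<subseteq> corner" using g by blast
  ultimately show ?thesis by (intro card_inj_on_le[of g])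
qed

theorem card_le_endpoints: "card E \<le> card (fst ` E) + card (snd ` E)"
proof -
  define T where "T = {e \<in> E. e = up e}"
  define B where "B = {e \<in> E. e = down e}"
  have fins: "finite T" "finite B" using fin by (auto simp: T_def B_def)
  have "E = (T \<union> B) \<union> inner" "(T \<union> B) \<inter> inner = {}" "corner = T \<inter> B"
    by (auto simp: T_def B_def inner_def corner_def)
  then have E: "card E = card (T \<union> B) + card inner"
    using fin by (metis card_Un_disjoint finite_Un)
  have TB: "card T + card B = card (T \<union> B) + card corner"
    unfolding \<open>corner = T \<inter> B\<close> by (rule card_Un_Int[OF fins])
  have T: "x \<in> E" "x = up x" if "x \<in> T" for x using that unfolding T_def by blast+
  have B: "x \<in> E" "x = down x" if "x \<in> B" for x using that unfolding B_def by blast+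
  have "inj_on fst T"
    by (rule inj_onI) (metis T(2))
  then have "card T \<le> card (fst ` E)"
    by (rule card_inj_on_le) (use T(1) fin in blast)+
  moreover have "inj_on snd B"
    by (rule inj_onI) (metis B(2))
  then have "card B \<le> card (snd ` E)"
    by (rule card_inj_on_le) (use B(1) fin in blast)+
  ultimately show ?thesis using E TB card_inner_le_card_corner by linarith
qed

end

section \<open>Cyclic intervals\<close>

text \<open>The cyclic interval from \<open>l\<close> up to but excluding \<open>r\<close>, in the cyclic order of \<open>{1..n}\<close>. With half-open
intervals the nonempty proper ones correspond exactly to the pairs \<open>l \<noteq> r\<close>.\<close>

definition arc :: "nat \<Rightarrow> nat \<Rightarrow> nat \<Rightarrow> nat set" where
  "arc n l r = (if l < r then {l..<r} else {1..<r} \<union> {l..n})"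

definition arcs :: "nat \<Rightarrow> (nat \<times> nat) set" where
  "arcs n = {(l, r). l \<in> {1..n} \<and> r \<in> {1..n} \<and> l \<noteq> r}"

lemma finite_arcs: "finite (arcs n)"
  by (rule finite_subset[of _ "{1..n} \<times> {1..n}"]) (auto simp: arcs_def)

text \<open>Inclusion becomes linear arithmetic on endpoints, split by which intervals wrap around. The
facts about nesting and crossing are then decidable case distinctions.\<close>

lemma arc_subset_iff:
  assumes "(l, r) \<in> arcs n" "(l', r') \<in> arcs n"
  shows "arc n l r \<subseteq> arc n l' r' \<longleftrightarrow>
    (if l < r then (if l' < r' then l' \<le> l \<and> r \<le> r' else l' \<le> l \<or> r \<le> r')
     else r' < l' \<and> l' \<le> l \<and> r \<le> r')"
proof -
  have b: "1 \<le> l" "l \<le> n" "1 \<le> r" "r \<le> n" "l \<noteq> r" "1 \<le> l'" "l' \<le> n" "1 \<le> r'" "r' \<le> n" "l' \<noteq> r'"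
    using assms by (auto simp: arcs_def)
  show ?thesis (is "?L \<longleftrightarrow> ?R")
  proof
    assume ?R
    then show ?L using b by (auto simp: arc_def split: if_splits)
  next
    assume L: ?L
    show ?R
    proof (cases "l < r")
      case True
      then have "l \<in> arc n l r" "r - 1 \<in> arc n l r" by (auto simp: arc_def)
      with L have "l \<in> arc n l' r'" "r - 1 \<in> arc n l' r'" by auto
      have "r' \<notin> arc n l' r'"
        using b by (auto simp: arc_def)
      with L have "r' \<notin> arc n l r" by blast
      then have nr: "\<not> (l \<le> r' \<and> r' < r)" using True by (simp add: arc_def)
      show ?thesis
        using True b nr \<open>l \<in> arc n l' r'\<close> \<open>r - 1 \<in> arc n l' r'\<close>
        by (cases "l' < r'") (simp_all add: arc_def, linarith+)
    next
      case False
      have "n \<in> arc n l' r'" using L b False by (auto simp: arc_def)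
      then have w: "r' < l'" using b by (auto simp: arc_def split: if_splits)
      have "l' \<le> l"
      proof (rule ccontr)
        assume "\<not> l' \<le> l"
        then have "l' - 1 \<in> arc n l r"
          using b w False by (auto simp: arc_def)
        then have "l' - 1 \<in> arc n l' r'" using L by auto
        with w b \<open>\<not> l' \<le> l\<close> show False by (auto simp: arc_def split: if_splits)
      qed
      moreover have "r \<le> r'"
      proof (rule ccontr)
        assume "\<not> r \<le> r'"
        then have "r' \<in> arc n l r" using b w False by (auto simp: arc_def)
        then have "r' \<in> arc n l' r'" using L by auto
        with w b show False by (auto simp: arc_def split: if_splits)
      qed
      ultimately show ?thesis using w False by auto
    qed
  qed
qed

lemma inj_on_arc: "inj_on (case_prod (arc n)) (arcs n)"
proof (rule inj_onI; clarify)
  fix l r l' r' assume *: "(l, r) \<in> arcs n" "(l', r') \<in> arcs n" and "arc n l r = arc n l' r'"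
  then have "arc n l r \<subseteq> arc n l' r'" "arc n l' r' \<subseteq> arc n l r" by auto
  with * have "l = l' \<and> r = r'"
    unfolding arc_subset_iff[OF *] arc_subset_iff[OF *(2,1)]
    by (auto simp: arcs_def split: if_splits)
  then show "l = l' \<and> r = r'" .
qed

lemma arc_same_left:
  assumes "(l, r) \<in> arcs n" "(l, r') \<in> arcs n"
  shows "arc n l r \<subseteq> arc n l r' \<or> arc n l r' \<subseteq> arc n l r"
  unfolding arc_subset_iff[OF assms] arc_subset_iff[OF assms(2,1)]
  using assms by (auto simp: arcs_def)

lemma arc_same_right:
  assumes "(l, r) \<in> arcs n" "(l', r) \<in> arcs n"
  shows "arc n l r \<subseteq> arc n l' r \<or> arc n l' r \<subseteq> arc n l r"
  unfolding arc_subset_iff[OF assms] arc_subset_iff[OF assms(2,1)]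
  using assms by (auto simp: arcs_def)

text \<open>In cyclic order starting at \<open>l\<close>, the points come as \<open>l, l', r, r'\<close>. If \<open>l''\<close> is not beyond \<open>l'\<close>, the first
inclusion holds. Otherwise \<open>c\<close> ends after \<open>r\<close>: either up to \<open>r'\<close>, and then it lies in \<open>d\<close>, or
beyond \<open>r'\<close>, and then it covers everything from \<open>l'\<close> to \<open>r'\<close>, in particular \<open>a\<close>.\<close>

lemma arc_crossing:
  assumes e: "(l, r) \<in> arcs n" and d: "(l, r') \<in> arcs n" and b: "(l', r) \<in> arcs n"
    and a: "(l'', r') \<in> arcs n" and c: "(l', r'') \<in> arcs n"
    and "arc n l' r \<subset> arc n l r" "arc n l r \<subset> arc n l r'"
      "arc n l'' r' \<subset> arc n l r'" "arc n l' r \<subset> arc n l' r''"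
  shows "arc n l' r \<subseteq> arc n l'' r' \<or> arc n l' r'' \<subseteq> arc n l r' \<or> arc n l'' r' \<subseteq> arc n l' r''"
  using assms(1-5) assms(6-9)[THEN psubset_imp_subset]
  unfolding arc_subset_iff[OF b e] arc_subset_iff[OF e d] arc_subset_iff[OF a d]
    arc_subset_iff[OF b c] arc_subset_iff[OF b a] arc_subset_iff[OF c d] arc_subset_iff[OF a c]
  by (auto simp: arcs_def split: if_splits)

lemma arc_subset: "(l, r) \<in> arcs n \<Longrightarrow> arc n l r \<subseteq> {1..n}"
  by (auto simp: arcs_def arc_def)

lemma card_arc:
  assumes "(l, r) \<in> arcs n"
  shows "card (arc n l r) = (if l < r then r - l else n + r - l)"
proof (cases "l < r")
  case False
  then have "arc n l r = {1..<r} \<union> {l..n}" "{1..<r} \<inter> {l..n} = {}"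
    by (auto simp: arc_def)
  then have "card (arc n l r) = card {1..<r} + card {l..n}"
    by (simp only: card_Un_disjoint finite_atLeastLessThan finite_atLeastAtMost)
  with False assms show ?thesis by (auto simp: arcs_def)
qed (auto simp: arc_def)

lemma card_arcs_of_size:
  assumes "0 < k" "k < n"
  shows "card {x \<in> arcs n. card (case_prod (arc n) x) = k} = n"
proof -
  have "bij_betw fst {x \<in> arcs n. card (case_prod (arc n) x) = k} {1..n}"
  proof (rule bij_betw_byWitness[where f' = "\<lambda>l. (l, if l + k \<le> n then l + k else l + k - n)"])
    show "\<forall>x\<in>{x \<in> arcs n. card (case_prod (arc n) x) = k}.
        (fst x, if fst x + k \<le> n then fst x + k else fst x + k - n) = x"
      by (auto simp: card_arc) (auto simp: arcs_def)
    have "(l, if l + k \<le> n then l + k else l + k - n) \<in> arcs n" if "l \<in> {1..n}" for l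
      using that assms by (auto simp: arcs_def)
    then show "(\<lambda>l. (l, if l + k \<le> n then l + k else l + k - n)) ` {1..n}
        \<subseteq> {x \<in> arcs n. card (case_prod (arc n) x) = k}"
      using assms by (force simp: card_arc split: if_splits)
  qed (auto simp: arcs_def)
  then show ?thesis using bij_betw_same_card by fastforce
qed

section \<open>Averaging over cyclic orders\<close>

lemma exists_permutation_mapping:
  assumes "finite U" "A \<subseteq> U" "B \<subseteq> U" "card A = card B"
  obtains q where "q permutes U" "q ` A = B"
proof -
  have fins: "finite A" "finite B" using assms finite_subset by auto
  obtain f where f: "bij_betw f A B"
    using finite_same_card_bij[OF fins assms(4)] by auto
  have "card (U - A) = card (U - B)"
    using assms fins by (simp add: card_Diff_subset)
  then obtain g where g: "bij_betw g (U - A) (U - B)"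
    using finite_same_card_bij assms(1) by blast
  define q where "q x = (if x \<in> A then f x else if x \<in> U then g x else x)" for x
  have "bij_betw q A B" "bij_betw q (U - A) (U - B)"
    using f g by (subst bij_betw_cong[of _ q f] bij_betw_cong[of _ q g]; simp add: q_def)+
  then have "bij_betw q (A \<union> (U - A)) (B \<union> (U - B))"
    by (rule bij_betw_combine) auto
  then have "bij_betw q U U" using assms by (simp add: Un_absorb1)
  then have "q permutes U" by (rule bij_imp_permutes) (use assms in \<open>auto simp: q_def\<close>)
  moreover have "q ` A = B" using \<open>bij_betw q A B\<close> by (simp add: bij_betw_def)
  ultimately show thesis by (rule that)
qed

text \<open>By symmetry the number of permutations taking \<open>S\<close> to \<open>A\<close> is the same for all \<open>A\<close> of the size of \<open>S\<close>,
and every permutation takes \<open>S\<close> to exactly one of them.\<close>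

lemma card_permutations_mapping:
  assumes "finite U" "S \<subseteq> U" "A \<subseteq> U" "card S = card A"
  shows "card {p. p permutes U \<and> p ` S = A} * (card U choose card A) = fact (card U)"
proof -
  define N where "N B = {p. p permutes U \<and> p ` S = B}" for B
  have finN: "finite (N B)" for B
    unfolding N_def by (rule finite_subset[OF _ finite_permutations[OF assms(1)]]) auto
  have le: "card (N B) \<le> card (N B')" if B: "B \<subseteq> U" "B' \<subseteq> U" "card B = card B'" for B B'
  proof -
    obtain q where q: "q permutes U" "q ` B = B'"
      using exists_permutation_mapping[OF assms(1) B] .
    show ?thesis
    proof (rule card_inj_on_le[of "(\<circ>) q"])
      show "inj_on ((\<circ>) q) (N B)"
        using permutes_inj[OF q(1)] by (auto simp: inj_on_def fun_eq_iff dest: injD)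
      show "(\<circ>) q ` N B \<subseteq> N B'"
        using q by (auto simp: N_def permutes_compose image_comp[symmetric])
    qed (rule finN)
  qed
  let ?K = "{B. B \<subseteq> U \<and> card B = card A}"
  have "{p. p permutes U} = (\<Union>B\<in>?K. N B)"
  proof (intro equalityI subsetI; clarsimp)
    fix p assume p: "p permutes U"
    have "p ` S \<subseteq> U" using permutes_image[OF p] assms(2) by blast
    moreover have "card (p ` S) = card A"
      using assms(4) permutes_inj_on[OF p] by (simp add: card_image)
    ultimately show "\<exists>B\<subseteq>U. card B = card A \<and> p \<in> N B"
      using p by (auto simp: N_def)
  qed (auto simp: N_def)
  then have "fact (card U) = card (\<Union>B\<in>?K. N B)"
    using card_permutations[OF refl assms(1)] by simp
  also have "\<dots> = (\<Sum>B\<in>?K. card (N B))"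
    by (rule card_UN_disjoint) (use assms(1) finN in \<open>auto simp: N_def\<close>)
  also have "\<dots> = (\<Sum>B\<in>?K. card (N A))"
    by (intro sum.cong refl antisym le) (use assms in auto)
  also have "\<dots> = (card U choose card A) * card (N A)"
    using n_subsets[OF assms(1)] by simp
  finally show ?thesis by (simp add: N_def mult.commute)
qed

text \<open>The images of arcs under a permutation are the intervals of an arbitrary cyclic order.\<close>

lemma card_arcs_in_family_le:
  assumes "p permutes {1..n}" "\<not> contains_skew F"
  shows "card {x \<in> arcs n. p ` case_prod (arc n) x \<in> F} \<le> 2 * n"
proof -
  define E where "E = {x \<in> arcs n. p ` case_prod (arc n) x \<in> F}"
  define I where "I x = p ` case_prod (arc n) x" for x
  have inj: "inj p" using assms(1) by (rule permutes_inj)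
  note simps = inj_image_subset_iff[OF inj] psubset_eq inj_image_eq_iff[OF inj]
  interpret crossing_family E I
  proof
    show "finite E" using finite_arcs[of n] by (simp add: E_def)
    show "inj_on I E"
      using inj_on_arc[of n] by (auto simp: inj_on_def I_def E_def inj_image_eq_iff[OF inj])
    show "I x \<subseteq> I y \<or> I y \<subseteq> I x" if "x \<in> E" "y \<in> E" "fst x = fst y" for x y
      using that arc_same_left
      by (cases x; cases y) (auto simp: E_def I_def inj_image_subset_iff[OF inj])
    show "I x \<subseteq> I y \<or> I y \<subseteq> I x" if "x \<in> E" "y \<in> E" "snd x = snd y" for x y
      using that arc_same_right
      by (cases x; cases y) (auto simp: E_def I_def inj_image_subset_iff[OF inj])
    show "I b \<subseteq> I a \<or> I c \<subseteq> I d \<or> I a \<subseteq> I c"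
      if "a \<in> E" "b \<in> E" "c \<in> E" "d \<in> E" "e \<in> E"
        "snd b = snd e" "fst e = fst d" "snd a = snd d" "fst c = fst b"
        "I b \<subset> I e" "I e \<subset> I d" "I a \<subset> I d" "I b \<subset> I c" for a b c d e
      using that arc_crossing[of "fst e" "snd e" n "snd d" "fst b" "fst a" "snd c"]
      by (cases a; cases b; cases c; cases d; cases e) (simp add: E_def I_def simps)
    have "I ` E \<subseteq> F" by (auto simp: I_def E_def)
    then show "\<not> contains_skew (I ` E)"
      using contains_skew_map[of "I ` E" id F] assms(2) by auto
  qed
  \<comment> \<open>Each point serves once as a left and once as a right endpoint, whence the bound \<open>n + n\<close>.\<close>
  have "fst ` E \<subseteq> {1..n}" "snd ` E \<subseteq> {1..n}" by (auto simp: E_def arcs_def)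
  then have "card (fst ` E) \<le> n" "card (snd ` E) \<le> n"
    using card_mono[of "{1..n}"] by force+
  then show ?thesis using card_le_endpoints by (simp add: E_def)
qed

text \<open>Double count the triples of a cyclic order \<open>p\<close>, an interval \<open>x\<close> of it and the member \<open>A\<close> of \<open>F\<close>
equal to that interval. Each \<open>p\<close> contributes at most \<open>2 * n\<close>. Each \<open>A\<close> is hit by \<open>n\<close> choices of an arc
of its size, for a fraction \<open>1 / (n choose card A)\<close> of all permutations.
The empty and the full set are excluded because they are not among the arcs.\<close>

lemma skew_free_LYM:
  assumes F: "F \<subseteq> Pow {1..n}" "{} \<notin> F" "{1..n} \<notin> F" and free: "\<not> contains_skew F"
    and "n > 0"
  shows "(\<Sum>A\<in>F. 1 / real (n choose card A)) \<le> 2"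
proof -
  define P where "P = {p. p permutes {1..n}}"
  let ?arc = "case_prod (arc n)"
  have finF: "finite F" using F(1) by (rule finite_subset) simp
  have finP: "finite P" by (simp add: P_def finite_permutations)
  have cardP: "card P = fact n" by (simp add: P_def card_permutations)
  have row: "real n * fact n * (1 / real (n choose card A))
      \<le> (\<Sum>x\<in>arcs n. real (card {p \<in> P. p ` ?arc x = A}))" if "A \<in> F" for A
  proof -
    let ?X = "{x \<in> arcs n. card (?arc x) = card A}"
    have A: "A \<subseteq> {1..n}" "A \<noteq> {}" "A \<noteq> {1..n}" using that F by auto
    then have fin: "finite A" using finite_subset by blast
    have "card A < n" using psubset_card_mono[of "{1..n}" A] A by auto
    moreover have "card A > 0" using A fin by (simp add: card_gt_0_iff)
    ultimately have X: "card ?X = n" by (intro card_arcs_of_size)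
    have "real (card {p \<in> P. p ` ?arc x = A}) = fact n / real (n choose card A)" if "x \<in> ?X" for x
    proof -
      have "?arc x \<subseteq> {1..n}" using that arc_subset by auto
      then have "card {p \<in> P. p ` ?arc x = A} * (n choose card A) = fact n"
        using card_permutations_mapping[of "{1..n}" "?arc x" A] A that by (simp add: P_def)
      then have "real (card {p \<in> P. p ` ?arc x = A}) * real (n choose card A) = fact n"
        by (metis of_nat_fact of_nat_mult)
      moreover have "n choose card A > 0" using \<open>card A < n\<close> by simp
      ultimately show ?thesis by (simp add: field_simps)
    qed
    then have "(\<Sum>x\<in>?X. real (card {p \<in> P. p ` ?arc x = A}))
        = real n * (fact n / real (n choose card A))"
      using X by simp
    moreover have "(\<Sum>x\<in>?X. real (card {p \<in> P. p ` ?arc x = A}))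
        \<le> (\<Sum>x\<in>arcs n. real (card {p \<in> P. p ` ?arc x = A}))"
      by (rule sum_mono2) (auto simp: finite_arcs)
    ultimately show ?thesis by simp
  qed
  have "real n * fact n * (\<Sum>A\<in>F. 1 / real (n choose card A))
      \<le> (\<Sum>A\<in>F. \<Sum>x\<in>arcs n. real (card {p \<in> P. p ` ?arc x = A}))"
    unfolding sum_distrib_left by (intro sum_mono row)
  also have "\<dots> = (\<Sum>A\<in>F. \<Sum>x\<in>arcs n. \<Sum>p\<in>P. of_bool (p ` ?arc x = A))"
    using finP by (simp add: of_bool_def sum.If_cases Int_def)
  also have "\<dots> = (\<Sum>p\<in>P. \<Sum>x\<in>arcs n. \<Sum>A\<in>F. of_bool (p ` ?arc x = A))"
    by (subst sum.swap, subst (2) sum.swap, subst sum.swap, rule refl)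
  also have "\<dots> = (\<Sum>p\<in>P. real (card {x \<in> arcs n. p ` ?arc x \<in> F}))"
    using finF finite_arcs[of n] by (simp add: of_bool_def sum.If_cases Int_def)
  also have "\<dots> \<le> (\<Sum>p\<in>P. real (2 * n))"
  proof (rule sum_mono)
    fix p assume "p \<in> P"
    then show "real (card {x \<in> arcs n. p ` ?arc x \<in> F}) \<le> real (2 * n)"
      using card_arcs_in_family_le[of p n F] free unfolding P_def of_nat_le_iff by blast
  qed
  also have "\<dots> = real n * fact n * 2" by (simp add: cardP)
  finally show ?thesis using \<open>n > 0\<close> by (simp add: mult_le_cancel_left_pos)
qed

section \<open>The two largest binomial coefficients\<close>

lemma sum_list_take2_rev_sort:
  fixes u v :: nat
  assumes "mset xs = add_mset u (add_mset v (mset ys))" "v \<le> u" "\<And>y. y \<in> set ys \<Longrightarrow> y \<le> v"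
  shows "sum_list (take 2 (rev (sort xs))) = u + v"
proof -
  have "sort xs = sort ys @ [v, u]"
    by (rule properties_for_sort) (use assms in \<open>auto simp: sorted_append intro: order_trans\<close>)
  then show ?thesis by (simp add: numeral_2_eq_2)
qed

text \<open>For even \<open>n\<close> the second largest coefficient is attained at both neighbours of the middle, so
the upper one is a valid choice for either parity.\<close>

lemma binomial_le_upper_middle:
  assumes "i \<le> n" "i \<noteq> n div 2"
  shows "n choose i \<le> n choose Suc (n div 2)"
proof (cases "i \<le> n div 2")
  case True
  then have "i \<le> n - Suc (n div 2)" "2 * (n - Suc (n div 2)) \<le> n" "Suc (n div 2) \<le> n"
    using assms by linarith+
  then show ?thesis using binomial_mono[of i "n - Suc (n div 2)" n] binomial_symmetric[of "Suc (n div 2)" n]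
    by simp
qed (rule binomial_antimono; use assms in linarith)

lemma sum_largest_binomials_2:
  assumes "n > 0"
  shows "sum_largest_binomials n 2 = (n choose (n div 2)) + (n choose Suc (n div 2))"
proof -
  let ?h = "n div 2"
  have h: "Suc ?h \<le> n" using assms by linarith
  then have "[0..<Suc n] = [0..<?h] @ ?h # Suc ?h # [Suc (Suc ?h)..<Suc n]"
    by (metis (no_types, lifting) Suc_leD le_SucI le_imp_less_Suc upt_add_eq_append upt_conv_Cons le0 less_Suc_eq_le le_add_diff_inverse)
  then have "mset (map ((choose) n) [0..<Suc n]) = add_mset (n choose ?h) (add_mset (n choose Suc ?h)
      (mset (map ((choose) n) ([0..<?h] @ [Suc (Suc ?h)..<Suc n]))))"
    by simp
  then show ?thesis unfolding sum_largest_binomials_def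
    by (rule sum_list_take2_rev_sort) (auto intro: binomial_maximum binomial_le_upper_middle)
qed

text \<open>Let \<open>u \<ge> v\<close> be the two largest coefficients and \<open>m \<le> u\<close> the number of members on the level of \<open>u\<close>.
Every other member has weight at least \<open>1 / v\<close>, so \<open>m / u + (card F - m) / v \<le> 2\<close>, which rearranges to
\<open>card F \<le> 2 * v + m * (1 - v / u) \<le> u + v\<close>.\<close>

lemma card_le_of_LYM:
  assumes F: "F \<subseteq> Pow {1..n}" and LYM: "(\<Sum>A\<in>F. 1 / real (n choose card A)) \<le> 2" and "n > 0"
  shows "card F \<le> (n choose (n div 2)) + (n choose Suc (n div 2))"
proof -
  define h where "h = n div 2"
  define u v where "u = real (n choose h)" and "v = real (n choose Suc h)"
  have "Suc h \<le> n" using \<open>n > 0\<close> unfolding h_def by linarith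
  then have pos: "u > 0" "v > 0" by (simp_all add: u_def v_def)
  have "v \<le> u" unfolding u_def v_def h_def by (simp add: binomial_maximum)
  define M where "M = {A \<in> F. card A = h}"
  have finF: "finite F" using F by (rule finite_subset) simp
  have finM: "finite M" using finF by (simp add: M_def)
  have "card M \<le> card {A. A \<subseteq> {1..n} \<and> card A = h}"
    by (rule card_mono) (use F in \<open>auto simp: M_def\<close>)
  then have M: "real (card M) \<le> u" by (simp add: n_subsets u_def)
  have "card (F - M) / v = (\<Sum>A\<in>F - M. 1 / v)" by simp
  also have "\<dots> \<le> (\<Sum>A\<in>F - M. 1 / real (n choose card A))"
  proof (rule sum_mono)
    fix A assume A: "A \<in> F - M"
    then have "card A \<le> n" using F card_mono[of "{1..n}" A] by auto
    moreover have "card A \<noteq> n div 2" using A by (auto simp: M_def h_def)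
    ultimately have "n choose card A \<le> n choose Suc h" "n choose card A > 0"
      unfolding h_def by (simp_all add: binomial_le_upper_middle)
    then show "1 / v \<le> 1 / real (n choose card A)"
      using pos by (auto simp: v_def intro!: divide_left_mono)
  qed
  finally have "card M / u + card (F - M) / v
      \<le> (\<Sum>A\<in>M. 1 / real (n choose card A)) + (\<Sum>A\<in>F - M. 1 / real (n choose card A))"
    by (simp add: M_def u_def)
  also have "\<dots> = (\<Sum>A\<in>F. 1 / real (n choose card A))"
    using finF by (subst sum.subset_diff[of M F]) (auto simp: M_def)
  finally have "card M / u + card (F - M) / v \<le> 2" using LYM by linarith
  then have "card M * v + card (F - M) * u \<le> 2 * u * v"
    using pos by (simp add: field_simps)
  moreover have "0 \<le> (u - card M) * (u - v)" using M \<open>v \<le> u\<close> by simp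
  ultimately have "u * (card M + card (F - M)) \<le> u * (u + v)"
    by (simp add: algebra_simps)
  then have "real (card M + card (F - M)) \<le> u + v" using pos by simp
  moreover have "card F = card M + card (F - M)"
    using finF by (metis (no_types, lifting) M_def card_Diff_subset card_mono finM le_add_diff_inverse mem_Collect_eq subsetI)
  ultimately show ?thesis unfolding u_def v_def h_def by (metis of_nat_add of_nat_le_iff)
qed

section \<open>Exchanging the empty set and the full set\<close>

text \<open>The skew-butterfly contains the three-chain \<open>b\<close>, \<open>e\<close>, \<open>d\<close>.\<close>

lemma two_levels_skew_free:
  assumes "\<And>A. A \<in> F \<Longrightarrow> finite A \<and> (card A = h \<or> card A = Suc h)"
  shows "\<not> contains_skew F"
proof
  assume "contains_skew F"
  then obtain b e d where *: "b \<in> F" "e \<in> F" "d \<in> F" "b \<subset> e" "e \<subset> d"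
    unfolding contains_skew_def by auto
  then have "card b < card e" "card e < card d"
    using assms by (auto intro: psubset_card_mono)
  with assms[OF *(1)] assms[OF *(2)] assms[OF *(3)] show False by auto
qed

text \<open>The empty set can be traded for a small set \<open>Y\<close>. A missing singleton has no proper subset in the new
family and lies below fewer sets than the empty set does, so it creates no skew-butterfly. If all singletons
are present, then members with at least two elements are pairwise disjoint: for a common element
\<open>z\<close> of \<open>A\<close> and \<open>B\<close> and another element \<open>w\<close> of \<open>B\<close>, the sets \<open>{z}, {}, A, B, {w}\<close> form a skew-butterfly.
Hence some pair is missing. After adding it, a skew-butterfly would have \<open>c\<close>, \<open>d\<close>, \<open>e\<close> all of size
at least two and sharing the elements of \<open>b\<close>, so two old members among them would not be disjoint.\<close>

lemma replace_empty_set: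
  assumes fin: "finite U" "card U \<ge> 3" and F: "F \<subseteq> Pow U" "{} \<in> F" and free: "\<not> contains_skew F"
  obtains G where "G \<subseteq> Pow U" "{} \<notin> G" "U \<in> G \<longrightarrow> U \<in> F" "card G = card F"
    "\<not> contains_skew G"
proof -
  have finF: "finite F" using F(1) fin(1) by (simp add: finite_subset)
  have "\<exists>Y. Y \<subseteq> U \<and> Y \<notin> F \<and> Y \<noteq> {} \<and> Y \<noteq> U \<and> \<not> contains_skew (insert Y (F - {{}}))"
  proof (cases "\<forall>x\<in>U. {x} \<in> F")
    case False
    then obtain x where x: "x \<in> U" "{x} \<notin> F" by blast
    let ?G = "insert {x} (F - {{}})"
    have "\<not> contains_skew ?G"
    proof
      let ?g = "\<lambda>A. if A = {x} then {} else A"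
      assume "contains_skew ?G"
      then have "contains_skew F"
      proof (rule contains_skew_map[where g = ?g])
        show "inj_on ?g ?G" by (auto simp: inj_on_def)
        show "?g ` ?G \<subseteq> F" using F(2) by auto
        show "?g A \<subseteq> ?g B" if "A \<in> ?G" "B \<in> ?G" "A \<subseteq> B" for A B
          using that by (auto simp: subset_singleton_iff)
      qed
      with free show False ..
    qed
    moreover have "{x} \<noteq> U" using fin(2) by auto
    ultimately show ?thesis using x by blast
  next
    case True
    have disjoint: "A \<inter> B = {}" if AB: "A \<in> F" "B \<in> F" "A \<noteq> B" and card: "\<nexists>z. A = {z}" "\<nexists>z. B = {z}"
      for A B
    proof (rule ccontr)
      assume "A \<inter> B \<noteq> {}"
      then obtain z where z: "z \<in> A" "z \<in> B" by blast
      then obtain w where w: "w \<in> B" "w \<noteq> z" using card(2) by blast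
      have "z \<in> U" "w \<in> U" using z w AB F(1) by blast+
      then have "{z} \<in> F" "{w} \<in> F" using True by auto
      moreover have "distinct [{z}, {}, A, B, {w}]"
        using z w AB card by auto
      ultimately have "contains_skew F"
        using AB z w F(2) by (intro contains_skewI[of "{z}" F "{}" A B "{w}"]) auto
      with free show False ..
    qed
    obtain T where T: "T \<subseteq> U" "card T = 3" using obtain_subset_with_card_n[OF fin(2)] by metis
    then obtain x y z where xyz: "x \<in> U" "y \<in> U" "z \<in> U" "x \<noteq> y" "x \<noteq> z" "y \<noteq> z"
      by (auto simp: card_3_iff)
    have "{x, y} \<notin> F \<or> {x, z} \<notin> F"
      using disjoint[of "{x, y}" "{x, z}"] xyz by (auto simp: doubleton_eq_iff)
    then obtain u where u: "u \<in> U" "u \<noteq> x" "{x, u} \<notin> F" using xyz by blast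
    let ?Y = "{x, u}"
    have "\<not> contains_skew (insert ?Y (F - {{}}))"
    proof
      assume "contains_skew (insert ?Y (F - {{}}))"
      then obtain a b c d e where mem: "b \<in> insert ?Y (F - {{}})" "c \<in> insert ?Y (F - {{}})"
          "d \<in> insert ?Y (F - {{}})" "e \<in> insert ?Y (F - {{}})"
        and dist: "distinct [a, b, c, d, e]"
        and sub: "b \<subseteq> c" "b \<subseteq> e" "e \<subseteq> d"
        by (rule contains_skewE)
      from dist have dist: "b \<noteq> c" "b \<noteq> e" "e \<noteq> d" "c \<noteq> d" "c \<noteq> e" by auto
      have inF: "A \<in> F" if "A \<in> insert ?Y (F - {{}})" "A \<noteq> ?Y" for A using that by blast
      have "b \<noteq> {}" using mem(1) by blast
      then obtain z where z: "z \<in> b" by blast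
      have ne: "c \<noteq> {w}" "e \<noteq> {w}" for w
        using \<open>b \<noteq> {}\<close> sub(1,2) dist(1,2) subset_singletonD by metis+
      then have ne': "d \<noteq> {w}" for w
        using sub(2,3) z subset_singletonD by (metis empty_iff subsetD)
      have "d \<noteq> ?Y"
      proof
        assume "d = ?Y"
        then have "e \<subset> {x, u}" using sub(3) dist(3) by blast
        moreover have "z \<in> e" using z sub(2) by blast
        ultimately have "e = {z}" by blast
        with ne show False by blast
      qed
      then have d: "d \<in> F" using inF mem(3) by blast
      show False
      proof (cases "e = ?Y")
        case True
        then have "c \<in> F" using inF mem(2) dist(5) by blast
        then have "c \<inter> d = {}" using disjoint[of c d] d dist(4) ne(1) ne' by blast
        then show False using z sub by blast
      next
        case False
        then have "e \<in> F" using inF mem(4) by blast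
        then have "e \<inter> d = {}" using disjoint[of e d] d dist(3) ne(2) ne' by blast
        then show False using z sub by blast
      qed
    qed
    moreover have "?Y \<noteq> U"
    proof
      assume "?Y = U"
      then have "card U = 2" using u(2) by (metis card_2_iff)
      with fin(2) show False by simp
    qed
    ultimately show ?thesis using u xyz by (intro exI[of _ ?Y] conjI) simp_all
  qed
  then obtain Y where Y: "Y \<subseteq> U" "Y \<notin> F" "Y \<noteq> {}" "Y \<noteq> U"
    "\<not> contains_skew (insert Y (F - {{}}))" by metis
  have "card F > 0" using finF F(2) by (auto simp: card_gt_0_iff)
  then have "card (insert Y (F - {{}})) = card F"
    using Y(2) finF F(2) by (simp add: card_Diff_singleton)
  moreover have "insert Y (F - {{}}) \<subseteq> Pow U" using Y(1) F(1) by blast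
  ultimately show thesis using Y(3-5) by (intro that[of "insert Y (F - {{}})"]) simp_all
qed

text \<open>Complementation reverses inclusion, and the skew-butterfly is self-dual.\<close>

lemma replace_full_set:
  assumes fin: "finite U" "card U \<ge> 3" and F: "F \<subseteq> Pow U" "U \<in> F" and free: "\<not> contains_skew F"
  obtains G where "G \<subseteq> Pow U" "U \<notin> G" "{} \<in> G \<longrightarrow> {} \<in> F" "card G = card F"
    "\<not> contains_skew G"
proof -
  let ?co = "\<lambda>A. U - A"
  have inj: "inj_on ?co H" if "H \<subseteq> Pow U" for H
    using that by (auto simp: inj_on_def)
  have co_free: "\<not> contains_skew (?co ` H)" if "H \<subseteq> Pow U" "\<not> contains_skew H" for H
  proof
    assume "contains_skew (?co ` H)"
    moreover have "?co ` ?co ` H \<subseteq> H" using that(1) by (auto simp: double_diff)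
    ultimately have "contains_skew H"
      by (intro contains_skew_antimap[of "?co ` H" ?co H]) (auto intro!: inj)
    with that(2) show False ..
  qed
  have "?co ` F \<subseteq> Pow U" "{} \<in> ?co ` F" using F(2) by auto
  from replace_empty_set[OF fin this co_free[OF F(1) free]]
  obtain G where G: "G \<subseteq> Pow U" "{} \<notin> G" "U \<in> G \<longrightarrow> U \<in> ?co ` F" "card G = card (?co ` F)"
    "\<not> contains_skew G" .
  show thesis
  proof (rule that[of "?co ` G"])
    show "?co ` G \<subseteq> Pow U" by blast
    have ex: "A = {}" if "A \<subseteq> U" "U - A = U" for A using that by blast
    show "U \<notin> ?co ` G"
    proof
      assume "U \<in> ?co ` G"
      then obtain A where A: "A \<in> G" "U - A = U" by (metis imageE)
      then have "A = {}" using ex G(1) by blast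
      with A(1) G(2) show False by simp
    qed
    show "{} \<in> ?co ` G \<longrightarrow> {} \<in> F"
    proof
      assume "{} \<in> ?co ` G"
      then obtain B where "B \<in> G" "U - B = {}" by (metis imageE)
      then have "U \<in> G" using G(1) by (metis Diff_eq_empty_iff PowD subsetD subset_antisym)
      then have "U \<in> ?co ` F" using G(3) by simp
      then obtain A where "A \<in> F" "U - A = U" by (metis imageE)
      then show "{} \<in> F" using ex F(1) by blast
    qed
    show "card (?co ` G) = card F" using G(1,4) inj F(1) by (simp add: card_image)
    show "\<not> contains_skew (?co ` G)" using co_free G by blast
  qed
qed

section \<open>The extremal number\<close>

theorem skew_free_card_le:
  assumes "n \<ge> 3" and F: "F \<subseteq> Pow {1..n}" and free: "\<not> contains_skew F"
  shows "card F \<le> (n choose (n div 2)) + (n choose Suc (n div 2))"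
proof -
  let ?U = "{1..n}"
  have U: "finite ?U" "card ?U \<ge> 3" using assms(1) by auto
  obtain G where G: "G \<subseteq> Pow ?U" "{} \<notin> G" "card G = card F" "\<not> contains_skew G"
    using replace_empty_set[OF U F _ free] F free by metis
  obtain H where H: "H \<subseteq> Pow ?U" "{} \<notin> H" "?U \<notin> H" "card H = card F" "\<not> contains_skew H"
    using replace_full_set[OF U G(1) _ G(4)] G by metis
  have "n > 0" using assms(1) by simp
  then show ?thesis
    using card_le_of_LYM[OF H(1) skew_free_LYM[OF H(1,2,3,5)]] H(4) by simp
qed

theorem theorem2:
  fixes n :: nat
  assumes "n \<ge> 3"
  shows "La n (UNIV :: skew_butterfly set) skew_le = sum_largest_binomials n 2"
proof -
  let ?h = "n div 2"
  let ?L = "\<lambda>k. {A. A \<subseteq> {1..n} \<and> card A = k}"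
  let ?sizes = "{card F | F :: nat set set. F \<subseteq> Pow {1..n} \<and> \<not> contains_skew F}"
  have "Max ?sizes = (n choose ?h) + (n choose Suc ?h)"
  proof (rule Max_eqI)
    show "finite ?sizes"
      by (rule finite_subset[of _ "card ` Pow (Pow {1..n})"]) auto
    show "s \<le> (n choose ?h) + (n choose Suc ?h)" if "s \<in> ?sizes" for s
      using that skew_free_card_le[OF assms] by auto
    have "\<not> contains_skew (?L ?h \<union> ?L (Suc ?h))"
      by (rule two_levels_skew_free[of _ ?h]) (use finite_subset[of _ "{1..n}"] in auto)
    moreover have "card (?L ?h \<union> ?L (Suc ?h)) = card (?L ?h) + card (?L (Suc ?h))"
      by (rule card_Un_disjoint) auto
    then have "card (?L ?h \<union> ?L (Suc ?h)) = (n choose ?h) + (n choose Suc ?h)"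
      by (simp add: n_subsets)
    ultimately show "(n choose ?h) + (n choose Suc ?h) \<in> ?sizes"
      by (intro CollectI exI[of _ "?L ?h \<union> ?L (Suc ?h)"]) auto
  qed
  moreover have "sum_largest_binomials n 2 = (n choose ?h) + (n choose Suc ?h)"
    using assms by (intro sum_largest_binomials_2) simp
  ultimately show ?thesis
    unfolding La_def contains_skew_iff_weak_subposet by simp
qed

end
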